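(* Let $R$ be a ring, and let $A\in R_3$ be a matrix with $\mathrm{diag}(A)=(a,b,c)$. For each $k\in\{1,2,3\}$ let $s_k,t_k,u_k\in R$, and suppose that $$a+b+c-\sum_{k=1}^{3}(s_k+t_k+u_k)$$ is a commutator in $R$. Then there exists an invertible matrix $U\in R_3$ such that $A$ admits a decomposition $$A=U\begin{pmatrix} s_1 & * & *\\ 0 & t_1 & *\\ 0 & 0 & u_1\end{pmatrix}U^{-1}+ \begin{pmatrix}s_2 & * & *\\ 0 & t_2 & *\\ 0 & 0 & u_2\end{pmatrix} + \begin{pmatrix}u_3 & 0 & 0\\ * & t_3 & 0\\ * & * & s_3\end{pmatrix},$$ where each $*$ stands for some element of $R$ (possibly different at each occurrence). Consequently, if $p_k=(X-s_k)(X-t_k)(X-u_k)$ for $k\in\{1,2,3\}$, and $s_1,t_1,u_1$ belong to the center of $R$, then $A$ has a decomposition $A=A_1+A_2+A_3$ with $A_1,A_2,A_3\in R_3$ such that $p_k(A_k)=0$ for all $k\in\{1,2,3\}$.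
   Context: All rings are unital and associative (not necessarily commutative). $R_3$ denotes the ring of $3\times 3$ matrices over $R$. For $A=(a_{ij})\in R_3$, $\mathrm{diag}(A)=(a_{11},a_{22},a_{33})$. An element $z\in R$ is a commutator if there exist $x,y\in R$ with $z=xy-yx$. The evaluation $p_k(A_k)$ means the ordered product $(A_k-s_kI)(A_k-t_kI)(A_k-u_kI)$, where $I$ is the identity matrix of $R_3$ and $sI$ is the diagonal matrix with all diagonal entries equal to $s$. *)

theory Defs
  imports "Jordan_Normal_Form.Matrix"
begin

text \<open>
  A unital associative ring is a type of sort \<open>{ring, monoid_mult}\<close>.  The class
  \<^class>\<open>ring_1\<close> would additionally demand \<open>0 \<noteq> 1\<close> and so exclude the zero ring.
  For the same reason \<open>invertible_mat\<close>, which lives in \<^class>\<open>semiring_1\<close>, is not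
  applicable; invertibility is stated below through its defining equations.
\<close>

definition is_commutator :: "'a :: ring \<Rightarrow> bool" where
  "is_commutator z \<longleftrightarrow> (\<exists>x y. z = x * y - y * x)"

definition central :: "'a :: times \<Rightarrow> bool" where
  "central z \<longleftrightarrow> (\<forall>x. z * x = x * z)"

definition inverse_pair :: "nat \<Rightarrow> 'a :: {ring, monoid_mult} mat \<Rightarrow> 'a mat \<Rightarrow> bool" where
  "inverse_pair n U V \<longleftrightarrow> U \<in> carrier_mat n n \<and> V \<in> carrier_mat n n \<and>
     U * V = 1\<^sub>m n \<and> V * U = 1\<^sub>m n"

definition mat3 :: "'a \<Rightarrow> 'a \<Rightarrow> 'a \<Rightarrow> 'a \<Rightarrow> 'a \<Rightarrow> 'a \<Rightarrow> 'a \<Rightarrow> 'a \<Rightarrow> 'a \<Rightarrow> 'a mat" where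
  "mat3 a11 a12 a13 a21 a22 a23 a31 a32 a33 =
     mat_of_rows_list 3 [[a11, a12, a13], [a21, a22, a23], [a31, a32, a33]]"

text \<open>
  Over a noncommutative ring the value of \<open>(X - s)(X - t)(X - u)\<close> at a \<open>3 \<times> 3\<close> matrix is
  by convention the product of the three factors, in this order.
\<close>

definition eval_cubic ::
  "'a :: {ring, monoid_mult} \<Rightarrow> 'a \<Rightarrow> 'a \<Rightarrow> 'a mat \<Rightarrow> 'a mat" where
  "eval_cubic s t u A = (A - s \<cdot>\<^sub>m 1\<^sub>m 3) * (A - t \<cdot>\<^sub>m 1\<^sub>m 3) * (A - u \<cdot>\<^sub>m 1\<^sub>m 3)"

end

theory Submission
  imports Defs
begin

text \<open>
  The strictly upper triangular part of the second summand and the strictly lower triangular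
  part of the third one are at our disposal, so only the diagonal of \<open>A\<close> is a constraint.
  The decomposition therefore amounts to the following: the conjugates of upper triangular
  matrices with diagonal \<open>(s, t, u)\<close> realise every diagonal \<open>(d1, d2, d3)\<close> for which
  \<open>d1 + d2 + d3 - (s + t + u)\<close> is a commutator.  This is lemma
  \<open>triangular_conjugate_prescribed_diagonal\<close>; its proof exhibits a lower unitriangular matrix
  that does the conjugation.  Over a commutative ring the traces would have to agree, and
  the commutator \<open>x * y - y * x\<close> measures exactly how far conjugation by this matrix moves the
  sum of the diagonal entries.

  For the consequence, a triangular matrix is annihilated by the product of its differences with
  its three diagonal entries, over any ring, provided that the factors come in the right order:
  from top to bottom for an upper triangular matrix, from bottom to top for a lower triangular
  one.  This explains the reversed diagonal of the third summand.  The first summand is only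
  conjugate to a triangular matrix, and centrality of its diagonal entries is what makes the
  scalar matrices commute with the conjugating matrix.
\<close>

section \<open>Explicit 3 by 3 matrices\<close>

lemma less_three_cases: "(i::nat) < 3 \<longleftrightarrow> i = 0 \<or> i = 1 \<or> i = 2"
  by presburger

lemma mat3_dim [simp]:
  "dim_row (mat3 a b c d e f g h k) = 3" "dim_col (mat3 a b c d e f g h k) = 3"
  by (simp_all add: mat3_def mat_of_rows_list_def)

lemma mat3_carrier [simp]: "mat3 a b c d e f g h k \<in> carrier_mat 3 3"
  by (rule carrier_matI) simp_all

lemma mat3_index:
  assumes "i < 3" "j < 3"
  shows "mat3 a b c d e f g h k $$ (i, j) = [[a, b, c], [d, e, f], [g, h, k]] ! i ! j"
  using assms by (simp add: mat3_def mat_of_rows_list_def)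

lemma mat3_eta:
  assumes "A \<in> carrier_mat 3 3"
  shows "A = mat3 (A $$ (0, 0)) (A $$ (0, 1)) (A $$ (0, 2))
                  (A $$ (1, 0)) (A $$ (1, 1)) (A $$ (1, 2))
                  (A $$ (2, 0)) (A $$ (2, 1)) (A $$ (2, 2))"
  using assms by (intro eq_matI) (auto simp: mat3_index less_three_cases)

lemma mat3_eta_diagonal:
  assumes "A \<in> carrier_mat 3 3" "A $$ (0, 0) = a" "A $$ (1, 1) = b" "A $$ (2, 2) = c"
  shows "A = mat3 a (A $$ (0, 1)) (A $$ (0, 2))
                  (A $$ (1, 0)) b (A $$ (1, 2))
                  (A $$ (2, 0)) (A $$ (2, 1)) c"
  using mat3_eta[OF assms(1)] unfolding assms(2-4) .

lemma mat3_cases: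
  assumes "A \<in> carrier_mat 3 3"
  obtains a b c d e f g h k where "A = mat3 a b c d e f g h k"
  using mat3_eta[OF assms] by blast

lemma mat3_add:
  "mat3 a b c d e f g h k + mat3 a' b' c' d' e' f' g' h' k' =
   mat3 (a + a') (b + b') (c + c') (d + d') (e + e') (f + f') (g + g') (h + h') (k + k')"
  by (intro eq_matI) (auto simp: mat3_index less_three_cases)

lemma mat3_diff:
  "mat3 a b c d e f g h k - mat3 a' b' c' d' e' f' g' h' k' =
   mat3 (a - a') (b - b') (c - c') (d - d') (e - e') (f - f') (g - g') (h - h') (k - k')"
  by (intro eq_matI) (auto simp: mat3_index less_three_cases)

lemma mat3_mult:
  fixes a :: "'a :: semiring_0"
  shows "mat3 a b c d e f g h k * mat3 a' b' c' d' e' f' g' h' k' =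
   mat3 (a * a' + b * d' + c * g') (a * b' + b * e' + c * h') (a * c' + b * f' + c * k')
        (d * a' + e * d' + f * g') (d * b' + e * e' + f * h') (d * c' + e * f' + f * k')
        (g * a' + h * d' + k * g') (g * b' + h * e' + k * h') (g * c' + h * f' + k * k')"
proof -
  have "{0..<3::nat} = {0, 1, 2}"
    by auto
  then show ?thesis
    by (intro eq_matI) (auto simp: mat3_index less_three_cases scalar_prod_def add.assoc)
qed

lemma mat3_zero: "0\<^sub>m 3 3 = mat3 0 0 0 0 0 0 0 0 0"
  by (intro eq_matI) (auto simp: mat3_index less_three_cases)

lemma mat3_one: "1\<^sub>m 3 = mat3 1 0 0 0 1 0 0 0 1"
  by (intro eq_matI) (auto simp: mat3_index less_three_cases)

lemma mat3_scalar:
  fixes s :: "'a :: {ring, monoid_mult}"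
  shows "s \<cdot>\<^sub>m 1\<^sub>m 3 = mat3 s 0 0 0 s 0 0 0 s"
  by (intro eq_matI) (auto simp: mat3_index less_three_cases)

lemma mat3_left_one:
  fixes X :: "'a :: {ring, monoid_mult} mat"
  assumes "X \<in> carrier_mat 3 3"
  shows "1\<^sub>m 3 * X = X"
  using assms by (rule mat3_cases) (simp add: mat3_one mat3_mult)

lemma mat3_right_one:
  fixes X :: "'a :: {ring, monoid_mult} mat"
  assumes "X \<in> carrier_mat 3 3"
  shows "X * 1\<^sub>m 3 = X"
  using assms by (rule mat3_cases) (simp add: mat3_one mat3_mult)

lemma central_scalar_commute:
  fixes X :: "'a :: {ring, monoid_mult} mat"
  assumes "X \<in> carrier_mat 3 3" "central s"
  shows "X * (s \<cdot>\<^sub>m 1\<^sub>m 3) = (s \<cdot>\<^sub>m 1\<^sub>m 3) * X"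
  using assms(1)
  by (rule mat3_cases) (use assms(2) in \<open>simp add: mat3_scalar mat3_mult central_def\<close>)

section \<open>Conjugates of triangular matrices with prescribed diagonal\<close>

text \<open>
  Conjugate by the lower unitriangular matrix with entries \<open>\<alpha>\<close>, \<open>\<beta>\<close>, \<open>\<gamma>\<close> in the positions
  \<open>(2,1)\<close>, \<open>(3,1)\<close>, \<open>(3,2)\<close>.  With \<open>p\<close>, \<open>q\<close>, \<open>r\<close> in the positions \<open>(1,2)\<close>, \<open>(1,3)\<close>, \<open>(2,3)\<close> of
  the triangular matrix, the new diagonal is
  \<open>s - p \<alpha> + q (\<gamma> \<alpha> - \<beta>)\<close>, \<open>t + \<alpha> p - (\<alpha> q + r) \<gamma>\<close>, \<open>u + \<beta> q + \<gamma> r\<close>.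
  For \<open>q = \<alpha> = 1\<close> the first two entries can be prescribed by solving for \<open>\<beta>\<close> and \<open>p\<close>, whatever
  \<open>\<gamma>\<close> and \<open>r\<close> are, and the sum of the three entries exceeds \<open>s + t + u\<close> by \<open>\<gamma> r - r \<gamma>\<close>.  So
  \<open>\<gamma> = x\<close> and \<open>r = y\<close> give the third entry as well.
\<close>

lemma triangular_conjugate_prescribed_diagonal:
  fixes s t u d1 d2 d3 :: "'a :: {ring, monoid_mult}"
  assumes "is_commutator (d1 + d2 + d3 - (s + t + u))"
  obtains U V p q r m12 m13 m21 m23 m31 m32 where
    "inverse_pair 3 U V"
    "U * mat3 s p q 0 t r 0 0 u * V = mat3 d1 m12 m13 m21 d2 m23 m31 m32 d3"
proof -
  obtain x y where xy: "d1 + d2 + d3 - (s + t + u) = x * y - y * x"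
    using assms unfolding is_commutator_def by blast
  define p where "p = d2 - t + (1 + y) * x"
  define \<beta> where "\<beta> = s - d1 - p + x"
  define U where "U = mat3 1 0 0 1 1 0 \<beta> x 1"
  define V where "V = mat3 1 0 0 (-1) 1 0 (x - \<beta>) (- x) 1"
  have inv: "inverse_pair 3 U V"
    by (simp add: inverse_pair_def U_def V_def mat3_mult mat3_one)
  have d3: "d3 = \<beta> + x * y + u"
    using xy by (simp add: \<beta>_def p_def algebra_simps)
  let ?M = "U * mat3 s p 1 0 t y 0 0 u * V"
  have M: "?M \<in> carrier_mat 3 3"
    by (simp add: U_def V_def mat3_mult)
  have "?M $$ (0, 0) = d1"
    by (simp add: U_def V_def mat3_mult mat3_index \<beta>_def algebra_simps)
  moreover have "?M $$ (1, 1) = d2"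
    by (simp add: U_def V_def mat3_mult mat3_index p_def algebra_simps)
  moreover have "?M $$ (2, 2) = d3"
    by (simp add: U_def V_def mat3_mult mat3_index d3)
  ultimately show thesis
    by (rule that[OF inv mat3_eta_diagonal[OF M]])
qed

section \<open>Triangular matrices annihilated by a cubic\<close>

text \<open>
  Write \<open>T\<close> for the matrix.  Below the first row, the product of the last two factors is zero:
  the last row of \<open>T - u I\<close> vanishes, and the second row of \<open>T - t I\<close> is zero outside the last
  column.  The first column of \<open>T - s I\<close> vanishes, so this factor kills what is left.
\<close>

lemma eval_cubic_upper_triangular:
  fixes s t u :: "'a :: {ring, monoid_mult}"
  shows "eval_cubic s t u (mat3 s x y 0 t z 0 0 u) = 0\<^sub>m 3 3"
  by (simp add: eval_cubic_def mat3_scalar mat3_diff mat3_mult mat3_zero)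

lemma eval_cubic_lower_triangular:
  fixes s t u :: "'a :: {ring, monoid_mult}"
  shows "eval_cubic s t u (mat3 u 0 0 x t 0 y z s) = 0\<^sub>m 3 3"
  by (simp add: eval_cubic_def mat3_scalar mat3_diff mat3_mult mat3_zero)

lemma conjugate_diff_central_scalar:
  fixes X :: "'a :: {ring, monoid_mult} mat"
  assumes UV: "inverse_pair 3 U V" and X: "X \<in> carrier_mat 3 3" and s: "central s"
  shows "U * X * V - s \<cdot>\<^sub>m 1\<^sub>m 3 = U * (X - s \<cdot>\<^sub>m 1\<^sub>m 3) * V"
proof -
  let ?S = "s \<cdot>\<^sub>m 1\<^sub>m 3"
  have U: "U \<in> carrier_mat 3 3" and V: "V \<in> carrier_mat 3 3" and UV1: "U * V = 1\<^sub>m 3"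
    using UV by (auto simp: inverse_pair_def)
  have S: "?S \<in> carrier_mat 3 3"
    by simp
  have "U * ?S * V = ?S * (U * V)"
    using U V S by (simp add: central_scalar_commute[OF U s] assoc_mult_mat[OF S U V])
  also have "\<dots> = ?S"
    using S by (simp only: UV1 mat3_right_one)
  finally have "U * ?S * V = ?S" .
  moreover have "U * (X - ?S) * V = U * X * V - U * ?S * V"
    using U V X S
    by (simp add: mult_minus_distrib_mat[OF U X S]
        minus_mult_distrib_mat[OF mult_carrier_mat[OF U X] mult_carrier_mat[OF U S] V])
  ultimately show ?thesis
    by simp
qed

lemma conjugate_mult:
  fixes X :: "'a :: {ring, monoid_mult} mat"
  assumes UV: "inverse_pair 3 U V" and X: "X \<in> carrier_mat 3 3" and Y: "Y \<in> carrier_mat 3 3"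
  shows "(U * X * V) * (U * Y * V) = U * (X * Y) * V"
proof -
  have U: "U \<in> carrier_mat 3 3" and V: "V \<in> carrier_mat 3 3" and VU1: "V * U = 1\<^sub>m 3"
    using UV by (auto simp: inverse_pair_def)
  have UYV: "U * (Y * V) \<in> carrier_mat 3 3" and YV: "Y * V \<in> carrier_mat 3 3"
    using U Y V by auto
  have "(U * X * V) * (U * Y * V) = U * X * (V * (U * (Y * V)))"
    using U X V Y UYV by (simp add: assoc_mult_mat[of _ 3 3 _ 3 _ 3])
  also have "V * (U * (Y * V)) = Y * V"
    using assoc_mult_mat[OF V U YV] VU1 YV by (simp add: mat3_left_one)
  also have "U * X * (Y * V) = U * (X * Y) * V"
    using U X V Y by (simp add: assoc_mult_mat[of _ 3 3 _ 3 _ 3])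
  finally show ?thesis .
qed

lemma eval_cubic_conjugate:
  fixes X :: "'a :: {ring, monoid_mult} mat"
  assumes UV: "inverse_pair 3 U V" and X: "X \<in> carrier_mat 3 3"
    and "central s" "central t" "central u"
  shows "eval_cubic s t u (U * X * V) = U * eval_cubic s t u X * V"
proof -
  have D: "X - w \<cdot>\<^sub>m 1\<^sub>m 3 \<in> carrier_mat 3 3" for w
    by (rule minus_carrier_mat) simp
  show ?thesis
    unfolding eval_cubic_def
    using assms
    by (simp only: conjugate_diff_central_scalar conjugate_mult[OF UV] D mult_carrier_mat[OF D D])
qed

section \<open>The decomposition\<close>

theorem corollary2p3:
  fixes A :: "'a :: {ring, monoid_mult} mat"
    and a b c :: 'a
    and s t u :: "nat \<Rightarrow> 'a"
  assumes "A \<in> carrier_mat 3 3"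
    and "diag_mat A = [a, b, c]"
    and "is_commutator (a + b + c - (\<Sum>k\<in>{1..3}. s k + t k + u k))"
  shows "(\<exists>U V x1 y1 z1 x2 y2 z2 x3 y3 z3.
            inverse_pair 3 U V \<and>
            A = U * mat3 (s 1) x1    y1
                         0     (t 1) z1
                         0     0     (u 1) * V
              + mat3 (s 2) x2    y2
                     0     (t 2) z2
                     0     0     (u 2)
              + mat3 (u 3) 0     0
                     x3    (t 3) 0
                     y3    z3    (s 3))
       \<and> (central (s 1) \<and> central (t 1) \<and> central (u 1) \<longrightarrow>
           (\<exists>B :: nat \<Rightarrow> 'a mat.
              (\<forall>k\<in>{1..3}. B k \<in> carrier_mat 3 3) \<and>
              A = B 1 + B 2 + B 3 \<and>
              (\<forall>k\<in>{1..3}. eval_cubic (s k) (t k) (u k) (B k) = 0\<^sub>m 3 3)))"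
proof (intro conjI impI)
  have A: "A = mat3 a (A $$ (0, 1)) (A $$ (0, 2))
                  (A $$ (1, 0)) b (A $$ (1, 2))
                  (A $$ (2, 0)) (A $$ (2, 1)) c"
    by (rule mat3_eta_diagonal)
       (use assms(1, 2) in \<open>simp_all add: diag_mat_def upt_rec numeral_2_eq_2\<close>)
  have "is_commutator ((a - s 2 - u 3) + (b - t 2 - t 3) + (c - u 2 - s 3) - (s 1 + t 1 + u 1))"
  proof -
    have "{1..3::nat} = {1, 2, 3}"
      by auto
    then have "(a - s 2 - u 3) + (b - t 2 - t 3) + (c - u 2 - s 3) - (s 1 + t 1 + u 1)
      = a + b + c - (\<Sum>k\<in>{1..3}. s k + t k + u k)"
      by (simp add: algebra_simps)
    then show ?thesis
      using assms(3) by (simp only:)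
  qed
  then obtain U V p q r m12 m13 m21 m23 m31 m32 where UV: "inverse_pair 3 U V"
    and M: "U * mat3 (s 1) p q 0 (t 1) r 0 0 (u 1) * V =
      mat3 (a - s 2 - u 3) m12 m13 m21 (b - t 2 - t 3) m23 m31 m32 (c - u 2 - s 3)"
    by (rule triangular_conjugate_prescribed_diagonal)
  let ?B1 = "U * mat3 (s 1) p q 0 (t 1) r 0 0 (u 1) * V"
  let ?B2 = "mat3 (s 2) (A $$ (0, 1) - m12) (A $$ (0, 2) - m13)
                  0     (t 2)               (A $$ (1, 2) - m23)
                  0     0                   (u 2)"
  let ?B3 = "mat3 (u 3)               0                   0
                  (A $$ (1, 0) - m21) (t 3)               0
                  (A $$ (2, 0) - m31) (A $$ (2, 1) - m32) (s 3)"
  have sum: "A = ?B1 + ?B2 + ?B3"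
    unfolding M mat3_add by (subst A) simp
  with UV show "\<exists>U V x1 y1 z1 x2 y2 z2 x3 y3 z3.
            inverse_pair 3 U V \<and>
            A = U * mat3 (s 1) x1 y1 0 (t 1) z1 0 0 (u 1) * V
              + mat3 (s 2) x2 y2 0 (t 2) z2 0 0 (u 2)
              + mat3 (u 3) 0 0 x3 (t 3) 0 y3 z3 (s 3)"
    by blast
  assume central: "central (s 1) \<and> central (t 1) \<and> central (u 1)"
  have "U \<in> carrier_mat 3 3" "V \<in> carrier_mat 3 3"
    using UV by (auto simp: inverse_pair_def)
  then have "eval_cubic (s 1) (t 1) (u 1) ?B1 = 0\<^sub>m 3 3"
    using central by (simp add: eval_cubic_conjugate[OF UV] eval_cubic_upper_triangular)
  moreover have "?B1 \<in> carrier_mat 3 3"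
    unfolding M by simp
  moreover have "{1..3::nat} = {1, 2, 3}"
    by auto
  ultimately show "\<exists>B :: nat \<Rightarrow> 'a mat.
      (\<forall>k\<in>{1..3}. B k \<in> carrier_mat 3 3) \<and>
      A = B 1 + B 2 + B 3 \<and>
      (\<forall>k\<in>{1..3}. eval_cubic (s k) (t k) (u k) (B k) = 0\<^sub>m 3 3)"
    using sum
    by (intro exI[of _ "\<lambda>k. if k = 1 then ?B1 else if k = 2 then ?B2 else ?B3"])
       (simp add: eval_cubic_upper_triangular eval_cubic_lower_triangular)
qed

end
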